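(* Let $n\geq 2$, let $\gamma_n$ be the chromatic number of the $n$-dimensional cyclohedron and let $\alpha_{n-1}$ be the chromatic number of the $(n-1)$-dimensional associahedron (with respect to proper colourings of facets). Then $$\alpha_{n-1}+1\leq\gamma_n\leq\alpha_{n-1}+n.$$
   Context: For $n\geq 1$ let $[n]=\{1,\ldots,n\}$ and $[n]_0=\{0,1,\ldots,n\}$. A building set is a collection $\mathcal{B}$ of nonempty subsets of $[n]_0$ containing all singletons $\{x\}$, $x\in[n]_0$, such that $S_1,S_2\in\mathcal{B}$ and $S_1\cap S_2\neq\emptyset$ imply $S_1\cup S_2\in\mathcal{B}$. For a family of sets $N$, an $N$-antichain is a subset $\{X_1,\ldots,X_m\}\subseteq N$ with $m\geq 2$ whose members are mutually incomparable with respect to $\subseteq$. Assuming $[n]_0\in\mathcal{B}$, a set $N\subseteq\mathcal{B}$ is nested when the union of every $N$-antichain is not an element of $\mathcal{B}$. The nested-set complex of $\mathcal{B}$ is the simplicial complex of all nested sets $N$ with $[n]_0\notin N$. It is realised by a simple $n$-dimensional polytope (the nestohedron of $\mathcal{B}$): its face lattice with the bottom (the empty face) removed is isomorphic to the complex ordered by $\supseteq$. Hence its facets are identified with the elements $X\in\mathcal{B}$, $X\neq[n]_0$, and two facets have a common vertex iff some nested set contains both. The $n$-dimensional associahedron is the nestohedron of the building set of all nonempty connected subsets of vertices of the path $0-1-\cdots-n$. The $n$-dimensional cyclohedron is the nestohedron of the building set of all nonempty connected subsets of vertices of the cycle $0-1-\cdots-n-0$. Two facets of a polytope are separated when they have no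 vertex in common. For $\mathcal{F}$ the set of facets of a polytope, a function $f\colon\mathcal{F}\to[m]$ is a proper colouring when every two (distinct) facets of the same colour are separated. The chromatic number of the polytope is the minimal $m$ such that a proper colouring of its facets with $m$ colours exists. *)

theory Defs
  imports "HOL-Analysis.Polytope"
begin

definition building_set :: "nat \<Rightarrow> nat set set \<Rightarrow> bool" where
  "building_set n B \<longleftrightarrow>
     (\<forall>S\<in>B. S \<noteq> {} \<and> S \<subseteq> {0..n}) \<and>
     (\<forall>x\<in>{0..n}. {x} \<in> B) \<and>
     (\<forall>S\<in>B. \<forall>T\<in>B. S \<inter> T \<noteq> {} \<longrightarrow> S \<union> T \<in> B)"

definition antichain_in :: "nat set set \<Rightarrow> nat set set \<Rightarrow> bool" where
  "antichain_in N A \<longleftrightarrow>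
     A \<subseteq> N \<and> finite A \<and> 2 \<le> card A \<and> (\<forall>X\<in>A. \<forall>Y\<in>A. X \<noteq> Y \<longrightarrow> \<not> X \<subseteq> Y)"

definition nested :: "nat set set \<Rightarrow> nat set set \<Rightarrow> bool" where
  "nested B N \<longleftrightarrow> N \<subseteq> B \<and> (\<forall>A. antichain_in N A \<longrightarrow> \<Union>A \<notin> B)"

definition nested_set_complex :: "nat \<Rightarrow> nat set set \<Rightarrow> nat set set set" where
  "nested_set_complex n B = {N. nested B N \<and> {0..n} \<notin> N}"

text \<open>
  A nestohedron is determined only up to combinatorial equivalence, so being one is a predicate on
  polytopes. Simplicity of the polytope is a consequence of the isomorphism and is not listed.
\<close>

definition is_nestohedron :: "nat \<Rightarrow> nat set set \<Rightarrow> 'a::euclidean_space set \<Rightarrow> bool" where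
  "is_nestohedron n B P \<longleftrightarrow>
     building_set n B \<and> {0..n} \<in> B \<and>
     polytope P \<and> aff_dim P = int n \<and>
     (\<exists>\<phi>. bij_betw \<phi> {F. F face_of P \<and> F \<noteq> {}} (nested_set_complex n B) \<and>
          (\<forall>F G. F face_of P \<and> F \<noteq> {} \<and> G face_of P \<and> G \<noteq> {} \<longrightarrow>
             (F \<subseteq> G \<longleftrightarrow> \<phi> F \<supseteq> \<phi> G)))"

text \<open>Graphs on \<open>{0..n}\<close> are given by symmetric edge relations.\<close>

definition path_edges :: "nat \<Rightarrow> (nat \<times> nat) set" where
  "path_edges n = {(i, j). i \<le> n \<and> j \<le> n \<and> (j = i + 1 \<or> i = j + 1)}"

definition cycle_edges :: "nat \<Rightarrow> (nat \<times> nat) set" where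
  "cycle_edges n = path_edges n \<union> {(n, 0), (0, n)}"

definition induces_connected :: "('v \<times> 'v) set \<Rightarrow> 'v set \<Rightarrow> bool" where
  "induces_connected E S \<longleftrightarrow> (\<forall>x\<in>S. \<forall>y\<in>S. (x, y) \<in> (E \<inter> S \<times> S)\<^sup>*)"

definition graphical_building_set :: "nat \<Rightarrow> (nat \<times> nat) set \<Rightarrow> nat set set" where
  "graphical_building_set n E = {S. S \<noteq> {} \<and> S \<subseteq> {0..n} \<and> induces_connected E S}"

definition is_associahedron :: "nat \<Rightarrow> 'a::euclidean_space set \<Rightarrow> bool" where
  "is_associahedron n P \<longleftrightarrow> is_nestohedron n (graphical_building_set n (path_edges n)) P"

definition is_cyclohedron :: "nat \<Rightarrow> 'a::euclidean_space set \<Rightarrow> bool" where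
  "is_cyclohedron n P \<longleftrightarrow> is_nestohedron n (graphical_building_set n (cycle_edges n)) P"

definition separated :: "'a::euclidean_space set \<Rightarrow> 'a set \<Rightarrow> 'a set \<Rightarrow> bool" where
  "separated P F G \<longleftrightarrow> \<not> (\<exists>v. v extreme_point_of P \<and> v \<in> F \<and> v \<in> G)"

definition proper_colouring ::
    "'a::euclidean_space set \<Rightarrow> nat \<Rightarrow> ('a set \<Rightarrow> nat) \<Rightarrow> bool" where
  "proper_colouring P m f \<longleftrightarrow>
     (\<forall>F. F facet_of P \<longrightarrow> f F \<in> {1..m}) \<and>
     (\<forall>F G. F facet_of P \<and> G facet_of P \<and> F \<noteq> G \<and> f F = f G \<longrightarrow> separated P F G)"

definition chromatic_number :: "'a::euclidean_space set \<Rightarrow> nat" where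
  "chromatic_number P = (LEAST m. \<exists>f. proper_colouring P m f)"

text \<open>The set over which the minimum is taken is nonempty for every polytope.\<close>

lemma ex_proper_colouring:
  assumes "polytope P"
  shows "\<exists>m f. proper_colouring P m f"
proof -
  have "finite {F. F facet_of P}"
    using assms by (simp add: finite_polytope_facets)
  then obtain f :: "'a set \<Rightarrow> nat" and m where "f ` {F. F facet_of P} = {i. i < m}"
    and inj: "inj_on f {F. F facet_of P}"
    using finite_imp_inj_to_nat_seg by metis
  moreover have "Suc (f F) \<le> m" if "F facet_of P" for F
    using that calculation(1) by (auto simp: Suc_le_eq)
  ultimately have "proper_colouring P m (\<lambda>F. Suc (f F))"
    by (auto simp: proper_colouring_def inj_on_def)
  then show ?thesis by blast
qed

text \<open>The building-set conditions in \<^const>\<open>is_nestohedron\<close> hold in the two cases of interest.\<close>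

lemma building_set_graphical: "building_set n (graphical_building_set n E)"
proof -
  have union: "induces_connected E (S \<union> T)"
    if S: "induces_connected E S" and T: "induces_connected E T" and z: "z \<in> S" "z \<in> T" for S T z
  proof -
    have mS: "(E \<inter> S \<times> S)\<^sup>* \<subseteq> (E \<inter> (S \<union> T) \<times> (S \<union> T))\<^sup>*"
      and mT: "(E \<inter> T \<times> T)\<^sup>* \<subseteq> (E \<inter> (S \<union> T) \<times> (S \<union> T))\<^sup>*"
      by (intro rtrancl_mono; blast)+
    have "(x, z) \<in> (E \<inter> (S \<union> T) \<times> (S \<union> T))\<^sup>* \<and> (z, x) \<in> (E \<inter> (S \<union> T) \<times> (S \<union> T))\<^sup>*"
      if "x \<in> S \<union> T" for x
      using that S T z mS mT unfolding induces_connected_def by blast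
    then show ?thesis
      unfolding induces_connected_def by (meson rtrancl_trans)
  qed
  show ?thesis
    unfolding building_set_def graphical_building_set_def
    using union by (auto simp: induces_connected_def[of _ "{_}"])
qed

lemma top_in_graphical:
  assumes "path_edges n \<subseteq> E"
  shows "{0..n} \<in> graphical_building_set n E"
proof -
  have "(0, k) \<in> (E \<inter> {0..n} \<times> {0..n})\<^sup>* \<and> (k, 0) \<in> (E \<inter> {0..n} \<times> {0..n})\<^sup>*" if "k \<le> n" for k
    using that
  proof (induction k)
    case (Suc k)
    then have "(k, Suc k) \<in> E \<inter> {0..n} \<times> {0..n}" "(Suc k, k) \<in> E \<inter> {0..n} \<times> {0..n}"
      using assms by (auto simp: path_edges_def)
    with Suc show ?case
      by (meson Suc_leD converse_rtrancl_into_rtrancl rtrancl.rtrancl_into_rtrancl)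
  qed simp
  then have "induces_connected E {0..n}"
    unfolding induces_connected_def by (meson atLeastAtMost_iff rtrancl_trans)
  then show ?thesis
    by (simp add: graphical_building_set_def)
qed

lemma graphical_building_sets_path_cycle:
  "building_set n (graphical_building_set n (path_edges n))"
  "{0..n} \<in> graphical_building_set n (path_edges n)"
  "building_set n (graphical_building_set n (cycle_edges n))"
  "{0..n} \<in> graphical_building_set n (cycle_edges n)"
  by (auto intro!: building_set_graphical top_in_graphical simp: cycle_edges_def)

end

theory Submission
  imports Defs
begin

text \<open>
  Both bounds are statements about building sets. In a nestohedron the facets are the elements of
  the building set other than the top, and two facets share a vertex exactly when the corresponding
  pair of sets is nested (\<open>nestohedron_facets\<close>); so the chromatic number is the least number of
  colours for these sets such that distinct sets of one colour are incomparable with union in the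
  building set (\<open>nested_pair_iff\<close>).

  Delete the vertex \<open>n\<close> from the cycle. The arcs avoiding \<open>n\<close> are exactly the intervals of the path
  \<open>0 - \<dots> - (n - 1)\<close>, so the associahedron comes from restricting the building set of the
  cyclohedron to the arc \<open>A = {0..n - 1}\<close>.

  Lower bound: \<open>A\<close> is comparable with all its proper subarcs, hence its colour in a colouring of the
  cyclohedron is absent from the facets of the associahedron, which therefore use one colour less.

  Upper bound: colour the proper subarcs of \<open>A\<close> as in the associahedron. The arcs left over are \<open>A\<close>
  and those containing \<open>n\<close>; they get \<open>n\<close> further colours according to their size. Distinct sets of
  equal size are incomparable; two arcs through \<open>n\<close> meet, and an arc through \<open>n\<close> together with
  \<open>A\<close> covers the whole cycle, so their unions are in the building set.
\<close>

section \<open>Facets of a nestohedron\<close>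

lemma facet_of_iff_maximal_proper_face:
  fixes P :: "'a::euclidean_space set"
  assumes "polytope P"
  shows "F facet_of P \<longleftrightarrow>
    F face_of P \<and> F \<noteq> {} \<and> F \<noteq> P \<and> (\<forall>G. G face_of P \<and> F \<subseteq> G \<longrightarrow> G = F \<or> G = P)"
    (is "?L \<longleftrightarrow> ?R")
proof
  assume F: ?L
  have "G = F" if G: "G face_of P" "F \<subseteq> G" "G \<noteq> P" for G
  proof (rule ccontr)
    assume "G \<noteq> F"
    have "convex P" "convex G"
      using assms G(1) by (auto simp: polytope_imp_convex face_of_imp_convex)
    have "F face_of G"
      using F G by (meson face_of_imp_subset face_of_subset facet_of_imp_face_of)
    then have "aff_dim F < aff_dim G"
      using \<open>convex G\<close> \<open>G \<noteq> F\<close> by (metis face_of_aff_dim_lt)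
    moreover have "aff_dim G < aff_dim P"
      using G \<open>convex P\<close> by (metis face_of_aff_dim_lt)
    ultimately show False
      using F by (simp add: facet_of_def)
  qed
  then show ?R
    using F by (auto simp: facet_of_def)
next
  assume R: ?R
  then obtain G where "G facet_of P" "F \<subseteq> G"
    using face_of_polyhedron_subset_facet[OF polytope_imp_polyhedron[OF assms]] by blast
  moreover then have "G = F"
    using R by (metis facet_of_imp_face_of facet_of_irrefl)
  ultimately show ?L by simp
qed

text \<open>The intersection of two faces is a face, and a nonempty one has a vertex by Krein-Milman.\<close>

lemma separated_iff_disjoint:
  fixes P :: "'a::euclidean_space set"
  assumes "polytope P" "F face_of P" "G face_of P"
  shows "separated P F G \<longleftrightarrow> F \<inter> G = {}"
proof
  have face: "F \<inter> G face_of P"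
    using assms(2,3) by (rule face_of_Int)
  assume sep: "separated P F G"
  show "F \<inter> G = {}"
  proof (rule ccontr)
    assume "F \<inter> G \<noteq> {}"
    moreover have "compact (F \<inter> G)" "convex (F \<inter> G)"
      using face face_of_polytope_polytope[OF assms(1)] polytope_imp_compact polytope_imp_convex
      by blast+
    ultimately obtain v where "v extreme_point_of (F \<inter> G)"
      using extreme_point_exists_convex by blast
    then have "v extreme_point_of P" "v \<in> F" "v \<in> G"
      using extreme_point_of_face[OF face] by auto
    with sep show False
      by (auto simp: separated_def)
  qed
qed (auto simp: separated_def)

lemma nested_subset: "nested B N \<Longrightarrow> M \<subseteq> N \<Longrightarrow> nested B M"
  unfolding nested_def antichain_in_def by (meson order_trans)

lemma nested_pair_iff:
  assumes "X \<in> B" "Y \<in> B"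
  shows "nested B {X, Y} \<longleftrightarrow> X \<subseteq> Y \<or> Y \<subseteq> X \<or> X \<union> Y \<notin> B"
proof
  assume N: "nested B {X, Y}"
  show "X \<subseteq> Y \<or> Y \<subseteq> X \<or> X \<union> Y \<notin> B"
  proof (rule ccontr)
    assume *: "\<not> ?thesis"
    then have "antichain_in {X, Y} {X, Y}"
      by (auto simp: antichain_in_def card_insert_if)
    with N have "\<Union>{X, Y} \<notin> B"
      unfolding nested_def by blast
    with * show False by simp
  qed
next
  assume R: "X \<subseteq> Y \<or> Y \<subseteq> X \<or> X \<union> Y \<notin> B"
  have "\<Union>A \<notin> B" if A: "antichain_in {X, Y} A" for A
  proof -
    have "A = {X, Y}" "X \<noteq> Y"
    proof -
      have sub: "A \<subseteq> {X, Y}" "2 \<le> card A"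
        using A by (auto simp: antichain_in_def)
      moreover have "card A \<le> card {X, Y}"
        using sub by (intro card_mono) auto
      moreover have "card {X, Y} \<le> 2"
        by (simp add: card_insert_if)
      ultimately show "A = {X, Y}"
        by (intro card_subset_eq) auto
      with sub show "X \<noteq> Y" by auto
    qed
    then show ?thesis
      using A R by (auto simp: antichain_in_def)
  qed
  then show "nested B {X, Y}"
    using assms by (auto simp: nested_def)
qed

lemma nested_empty: "nested B {}"
  by (auto simp: nested_def antichain_in_def)

text \<open>
  Facets are the maximal proper faces, so the order-reversing isomorphism takes them to the minimal
  nonempty nested sets, and these are singletons. Two facets meet in a nonempty face exactly when
  their singletons lie in a common nested set.
\<close>

lemma nestohedron_facets:
  fixes P :: "'a::euclidean_space set"
  assumes "is_nestohedron n B P"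
  obtains \<psi> where "bij_betw \<psi> {F. F facet_of P} (B - {{0..n}})"
    and "\<And>F G. F facet_of P \<Longrightarrow> G facet_of P \<Longrightarrow> separated P F G \<longleftrightarrow> \<not> nested B {\<psi> F, \<psi> G}"
proof -
  let ?faces = "{F. F face_of P \<and> F \<noteq> {}}" and ?K = "nested_set_complex n B"
  have P: "polytope P" "convex P" and dimP: "aff_dim P = int n"
    using assms by (auto simp: is_nestohedron_def polytope_imp_convex)
  obtain \<phi> where bij: "bij_betw \<phi> ?faces ?K"
    and iso: "\<forall>F G. F face_of P \<and> F \<noteq> {} \<and> G face_of P \<and> G \<noteq> {} \<longrightarrow>
      (F \<subseteq> G \<longleftrightarrow> \<phi> G \<subseteq> \<phi> F)"
    using assms unfolding is_nestohedron_def by (elim conjE exE)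
  have ord: "F \<subseteq> G \<longleftrightarrow> \<phi> G \<subseteq> \<phi> F" if "F \<in> ?faces" "G \<in> ?faces" for F G
    using iso that by simp
  have face: "\<exists>F\<in>?faces. \<phi> F = N" if "N \<in> ?K" for N
  proof -
    have "N \<in> \<phi> ` ?faces"
      using bij that by (simp add: bij_betw_def)
    then show ?thesis by fast
  qed
  have K: "\<phi> F \<in> ?K" if "F \<in> ?faces" for F
    using bij that unfolding bij_betw_def by fast
  have down: "M \<in> ?K" if "N \<in> ?K" "M \<subseteq> N" for M N
    using that nested_subset by (auto simp: nested_set_complex_def)
  have single: "{X} \<in> ?K" if "X \<in> B - {{0..n}}" for X
    using that nested_pair_iff[of X B X] by (auto simp: nested_set_complex_def)
  have inj: "F = G" if "\<phi> F = \<phi> G" "F \<in> ?faces" "G \<in> ?faces" for F G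
    using bij that unfolding bij_betw_def by (meson inj_onD)
  have top: "P \<in> ?faces"
    using dimP P(2) by (auto simp: face_of_refl)
  have "\<phi> P = {}"
  proof -
    have "{} \<in> ?K"
      by (simp add: nested_set_complex_def nested_empty)
    then obtain F where F: "F \<in> ?faces" "\<phi> F = {}"
      using face by blast
    have "F \<subseteq> P"
      using F(1) by (auto dest: face_of_imp_subset)
    moreover have "P \<subseteq> F"
      using ord[OF top F(1)] F(2) by simp
    ultimately show ?thesis
      using F(2) by simp
  qed
  have facet: "F facet_of P \<longleftrightarrow> (\<exists>X\<in>B - {{0..n}}. \<phi> F = {X})" if F: "F \<in> ?faces" for F
  proof
    assume "F facet_of P"
    then have max: "F \<noteq> P" "\<And>G. G face_of P \<Longrightarrow> F \<subseteq> G \<Longrightarrow> G = F \<or> G = P"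
      using facet_of_iff_maximal_proper_face[OF P(1)] by auto
    then obtain X where X: "X \<in> \<phi> F"
      using inj[OF _ F top] \<open>\<phi> P = {}\<close> by auto
    then have XB: "X \<in> B - {{0..n}}"
      using K[OF F] by (auto simp: nested_set_complex_def nested_def)
    obtain G where G: "G \<in> ?faces" "\<phi> G = {X}"
      using face[OF single[OF XB]] by blast
    then have "F \<subseteq> G"
      using ord[OF F] X by simp
    then have "G = F"
      using max(2)[of G] G \<open>\<phi> P = {}\<close> by force
    with G XB show "\<exists>X\<in>B - {{0..n}}. \<phi> F = {X}"
      by auto
  next
    assume "\<exists>X\<in>B - {{0..n}}. \<phi> F = {X}"
    then obtain X where X: "\<phi> F = {X}" by blast
    have "G = F \<or> G = P" if "G face_of P" "F \<subseteq> G" for G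
    proof -
      have G: "G \<in> ?faces"
        using that F by auto
      then have "\<phi> G = {} \<or> \<phi> G = {X}"
        using ord[OF F G] that(2) X by auto
      then show ?thesis
        using inj[OF _ G F] inj[OF _ G top] X \<open>\<phi> P = {}\<close> by auto
    qed
    moreover have "F \<noteq> P"
      using X \<open>\<phi> P = {}\<close> by auto
    ultimately show "F facet_of P"
      using F facet_of_iff_maximal_proper_face[OF P(1)] by auto
  qed
  define \<psi> where "\<psi> F = the_elem (\<phi> F)" for F
  have facet_face: "F \<in> ?faces" if "F facet_of P" for F
    using that by (auto simp: facet_of_def)
  have \<psi>: "\<phi> F = {\<psi> F}" "\<psi> F \<in> B - {{0..n}}" if F: "F facet_of P" for F
  proof -
    obtain X where "X \<in> B - {{0..n}}" "\<phi> F = {X}"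
      using facet[OF facet_face[OF F]] F by blast
    then show "\<phi> F = {\<psi> F}" "\<psi> F \<in> B - {{0..n}}"
      by (simp_all add: \<psi>_def)
  qed
  show thesis
  proof
    show "bij_betw \<psi> {F. F facet_of P} (B - {{0..n}})"
    proof (rule bij_betw_imageI)
      show "inj_on \<psi> {F. F facet_of P}"
      proof (rule inj_onI)
        fix F G assume "F \<in> {F. F facet_of P}" "G \<in> {F. F facet_of P}" "\<psi> F = \<psi> G"
        then show "F = G"
          using inj[of F G] \<psi>(1)[of F] \<psi>(1)[of G] facet_face[of F] facet_face[of G] by simp
      qed
      have "\<exists>F. F facet_of P \<and> \<psi> F = X" if X: "X \<in> B - {{0..n}}" for X
      proof -
        obtain F where F: "F \<in> ?faces" "\<phi> F = {X}"
          using face[OF single[OF X]] by blast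
        then show ?thesis
          using facet[OF F(1)] X by (intro exI[of _ F]) (simp add: \<psi>_def)
      qed
      then show "\<psi> ` {F. F facet_of P} = B - {{0..n}}"
        using \<psi>(2) by (intro subset_antisym image_subsetI subsetI) (simp, blast)
    qed
    fix F G assume FG: "F facet_of P" "G facet_of P"
    have "F \<inter> G \<noteq> {} \<longleftrightarrow> nested B {\<psi> F, \<psi> G}"
    proof
      assume "F \<inter> G \<noteq> {}"
      then have H: "F \<inter> G \<in> ?faces"
        using facet_face[OF FG(1)] facet_face[OF FG(2)] by (auto intro: face_of_Int)
      then have "{\<psi> F, \<psi> G} \<subseteq> \<phi> (F \<inter> G)"
        using ord[OF H facet_face[OF FG(1)]] ord[OF H facet_face[OF FG(2)]]
          \<psi>(1)[OF FG(1)] \<psi>(1)[OF FG(2)] by auto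
      then show "nested B {\<psi> F, \<psi> G}"
        using down[OF K[OF H]] by (auto simp: nested_set_complex_def)
    next
      assume "nested B {\<psi> F, \<psi> G}"
      then have "{\<psi> F, \<psi> G} \<in> ?K"
        using \<psi>(2)[OF FG(1)] \<psi>(2)[OF FG(2)] by (auto simp: nested_set_complex_def)
      then obtain H where H: "H \<in> ?faces" "\<phi> H = {\<psi> F, \<psi> G}"
        using face by blast
      then have "H \<subseteq> F" "H \<subseteq> G"
        using ord[OF H(1) facet_face[OF FG(1)]] ord[OF H(1) facet_face[OF FG(2)]]
          \<psi>(1)[OF FG(1)] \<psi>(1)[OF FG(2)] by auto
      with H(1) show "F \<inter> G \<noteq> {}" by blast
    qed
    then show "separated P F G \<longleftrightarrow> \<not> nested B {\<psi> F, \<psi> G}"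
      using separated_iff_disjoint[OF P(1)] FG by (auto dest: facet_of_imp_face_of)
  qed
qed

section \<open>Colourings of building sets\<close>

text \<open>
  By \<open>nested_pair_iff\<close>, the condition says that two distinct sets of one colour never form a nested
  pair; one of the two inclusions suffices because \<open>X\<close> and \<open>Y\<close> are interchangeable.
\<close>

definition building_colouring :: "nat \<Rightarrow> nat set set \<Rightarrow> nat \<Rightarrow> (nat set \<Rightarrow> nat) \<Rightarrow> bool" where
  "building_colouring n B m c \<longleftrightarrow>
     c ` (B - {{0..n}}) \<subseteq> {1..m} \<and>
     (\<forall>X\<in>B - {{0..n}}. \<forall>Y\<in>B - {{0..n}}. X \<noteq> Y \<and> c X = c Y \<longrightarrow>
        \<not> X \<subseteq> Y \<and> X \<union> Y \<in> B)"

lemma building_colouring_range: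
  "building_colouring n B m c \<Longrightarrow> X \<in> B - {{0..n}} \<Longrightarrow> c X \<in> {1..m}"
  by (simp add: building_colouring_def image_subset_iff)

lemma building_colouring_eqD:
  assumes "building_colouring n B m c" "X \<in> B - {{0..n}}" "Y \<in> B - {{0..n}}" "X \<noteq> Y" "c X = c Y"
  shows "\<not> X \<subseteq> Y" "\<not> Y \<subseteq> X" "X \<union> Y \<in> B"
proof -
  have *: "\<not> X \<subseteq> Y \<and> X \<union> Y \<in> B"
    if "X \<in> B - {{0..n}}" "Y \<in> B - {{0..n}}" "X \<noteq> Y" "c X = c Y" for X Y
    using assms(1) that unfolding building_colouring_def by simp
  show "\<not> X \<subseteq> Y" "\<not> Y \<subseteq> X" "X \<union> Y \<in> B"
    using *[of X Y] *[of Y X] assms by simp_all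
qed

lemma ex_proper_colouring_iff_building_colouring:
  fixes P :: "'a::euclidean_space set"
  assumes "is_nestohedron n B P"
  shows "(\<exists>f. proper_colouring P m f) \<longleftrightarrow> (\<exists>c. building_colouring n B m c)"
proof -
  let ?\<F> = "{F. F facet_of P}" and ?X = "B - {{0..n}}"
  obtain \<psi> where bij: "bij_betw \<psi> ?\<F> ?X"
    and sep: "\<And>F G. F facet_of P \<Longrightarrow> G facet_of P \<Longrightarrow>
      separated P F G \<longleftrightarrow> \<not> nested B {\<psi> F, \<psi> G}"
    using nestohedron_facets[OF assms] by blast
  have \<psi>: "\<psi> F \<in> ?X" if "F facet_of P" for F
    using bij that by (auto simp: bij_betw_def)
  show ?thesis
  proof
    assume "\<exists>f. proper_colouring P m f"
    then obtain f where f: "proper_colouring P m f" ..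
    define \<theta> where "\<theta> = inv_into ?\<F> \<psi>"
    have \<theta>: "\<theta> X facet_of P" "\<psi> (\<theta> X) = X" if "X \<in> ?X" for X
    proof -
      have X: "X \<in> \<psi> ` ?\<F>"
        using bij that by (simp add: bij_betw_def)
      show "\<theta> X facet_of P"
        using inv_into_into[OF X] by (simp add: \<theta>_def)
      show "\<psi> (\<theta> X) = X"
        using f_inv_into_f[OF X] by (simp add: \<theta>_def)
    qed
    have "building_colouring n B m (f \<circ> \<theta>)"
      unfolding building_colouring_def
    proof (intro conjI ballI impI image_subsetI)
      fix X assume "X \<in> ?X"
      then show "(f \<circ> \<theta>) X \<in> {1..m}"
        using f \<theta>(1) unfolding proper_colouring_def by simp
    next
      fix X Y assume XY: "X \<in> ?X" "Y \<in> ?X" "X \<noteq> Y \<and> (f \<circ> \<theta>) X = (f \<circ> \<theta>) Y"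
      then have "\<theta> X \<noteq> \<theta> Y"
        using \<theta>(2) by metis
      then have "separated P (\<theta> X) (\<theta> Y)"
        using f XY \<theta>(1) unfolding proper_colouring_def by simp
      then have "\<not> nested B {X, Y}"
        using sep[of "\<theta> X" "\<theta> Y"] \<theta> XY by simp
      then show "\<not> X \<subseteq> Y" "X \<union> Y \<in> B"
        using nested_pair_iff[of X B Y] XY by auto
    qed
    then show "\<exists>c. building_colouring n B m c"
      by blast
  next
    assume "\<exists>c. building_colouring n B m c"
    then obtain c where c: "building_colouring n B m c" ..
    have "proper_colouring P m (c \<circ> \<psi>)"
      unfolding proper_colouring_def
    proof (intro conjI allI impI)
      fix F assume "F facet_of P"
      then show "(c \<circ> \<psi>) F \<in> {1..m}"
        using building_colouring_range[OF c \<psi>] by simp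
    next
      fix F G assume FG: "F facet_of P \<and> G facet_of P \<and> F \<noteq> G \<and> (c \<circ> \<psi>) F = (c \<circ> \<psi>) G"
      then have "\<psi> F \<noteq> \<psi> G"
        using bij by (auto simp: bij_betw_def inj_on_def)
      then have "\<not> \<psi> F \<subseteq> \<psi> G \<and> \<not> \<psi> G \<subseteq> \<psi> F \<and> \<psi> F \<union> \<psi> G \<in> B"
        using building_colouring_eqD[OF c, of "\<psi> F" "\<psi> G"] \<psi> FG by simp
      then show "separated P F G"
        using sep FG nested_pair_iff[of "\<psi> F" B "\<psi> G"] \<psi> by auto
    qed
    then show "\<exists>f. proper_colouring P m f"
      by blast
  qed
qed

lemma chromatic_number_le:
  assumes "is_nestohedron n B P" "building_colouring n B m c"
  shows "chromatic_number P \<le> m"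
  unfolding chromatic_number_def
  using assms by (intro Least_le) (auto simp: ex_proper_colouring_iff_building_colouring)

lemma chromatic_number_attained:
  assumes "is_nestohedron n B P"
  obtains c where "building_colouring n B (chromatic_number P) c"
proof -
  have "polytope P"
    using assms by (simp add: is_nestohedron_def)
  then have "\<exists>f. proper_colouring P (chromatic_number P) f"
    unfolding chromatic_number_def using ex_proper_colouring by (rule_tac LeastI_ex) blast
  then show thesis
    using that ex_proper_colouring_iff_building_colouring[OF assms] by blast
qed

section \<open>Deleting a vertex\<close>

context
  fixes n :: nat and B B' :: "nat set set"
  assumes B: "building_set n B" and n: "n \<ge> 1"
    and top: "{0..n} \<in> B" and top': "{0..n - 1} \<in> B"
    and B': "B' = {S \<in> B. S \<subseteq> {0..n - 1}}"
begin

text \<open>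
  Every set in the restriction is comparable with the new top element \<open>{0..n - 1}\<close>, whose colour is
  therefore free; the sets of the largest colour are given this colour instead.
\<close>

lemma building_colouring_restrict:
  assumes "building_colouring n B m c"
  obtains c' where "m \<ge> 1" "building_colouring (n - 1) B' (m - 1) c'"
proof -
  let ?A = "{0..n - 1}"
  have A: "?A \<in> B - {{0..n}}"
    using top' n by auto
  have sub: "X \<in> B - {{0..n}} \<and> X \<subseteq> ?A \<and> X \<noteq> ?A" if "X \<in> B' - {?A}" for X
    using that n B' by auto
  have cA: "c ?A \<in> {1..m}"
    using building_colouring_range[OF assms A] .
  have c: "c X \<in> {1..m}" "c X \<noteq> c ?A" if "X \<in> B' - {?A}" for X
    using building_colouring_range[OF assms, of X] building_colouring_eqD(1)[OF assms _ A, of X]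
      sub[OF that] by auto
  define c' where "c' X = (if c X = m then c ?A else c X)" for X
  have "building_colouring (n - 1) B' (m - 1) c'"
    unfolding building_colouring_def
  proof (intro conjI ballI impI image_subsetI)
    fix X assume X: "X \<in> B' - {?A}"
    then show "c' X \<in> {1..m - 1}"
      using c[OF X] cA by (auto simp: c'_def)
  next
    fix X Y assume XY: "X \<in> B' - {?A}" "Y \<in> B' - {?A}" "X \<noteq> Y \<and> c' X = c' Y"
    then have "c X = c Y"
      using c(2)[OF XY(1)] c(2)[OF XY(2)] by (auto simp: c'_def split: if_splits)
    then have "\<not> X \<subseteq> Y \<and> X \<union> Y \<in> B"
      using building_colouring_eqD[OF assms, of X Y] XY(3) sub[OF XY(1)] sub[OF XY(2)] by simp
    then show "\<not> X \<subseteq> Y" "X \<union> Y \<in> B'"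
      using sub[OF XY(1)] sub[OF XY(2)] by (auto simp: B')
  qed
  moreover have "m \<ge> 1"
    using cA by auto
  ultimately show thesis
    using that by blast
qed

text \<open>
  The sets outside the restriction contain \<open>n\<close>; they and \<open>{0..n - 1}\<close> are coloured by cardinality,
  which makes equally coloured ones incomparable. Two sets containing \<open>n\<close> meet, and the union of
  \<open>{0..n - 1}\<close> with one of them is \<open>{0..n}\<close>.
\<close>

lemma building_colouring_extend:
  assumes "building_colouring (n - 1) B' m c"
  obtains c' where "building_colouring n B (m + n) c'"
proof -
  let ?A = "{0..n - 1}"
  define c' where "c' X = (if X \<in> B' - {?A} then c X else m + card X)" for X
  have BX: "X \<noteq> {}" "X \<subseteq> {0..n}" "finite X" if "X \<in> B" for X
    using B that finite_subset[of X "{0..n}"] by (auto simp: building_set_def)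
  have low: "c' X \<in> {1..m}" if "X \<in> B' - {?A}" for X
    using building_colouring_range[OF assms that] that unfolding c'_def by simp
  have high: "c' X = m + card X" "0 < card X" "card X \<le> n" if "X \<in> B - {{0..n}}" "X \<notin> B' - {?A}" for X
  proof -
    show "c' X = m + card X"
      using that(2) unfolding c'_def by meson
    show "0 < card X"
      using that BX[of X] by (simp add: card_gt_0_iff)
    have "card X < card {0..n}"
      using that BX(2)[of X] by (intro psubset_card_mono) auto
    then show "card X \<le> n" by simp
  qed
  have outside: "n \<in> X \<or> X = ?A" if "X \<in> B" "X \<notin> B' - {?A}" for X
  proof (rule disjCI)
    assume "X \<noteq> ?A"
    with that have "\<not> X \<subseteq> ?A"
      by (auto simp: B')
    then obtain x where "x \<in> X" "\<not> x \<le> n - 1" by (auto simp: subset_eq)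
    then show "n \<in> X"
      using BX(2)[OF that(1)] by (cases "x = n") auto
  qed
  have join: "X \<union> Y \<in> B" if X: "X \<in> B" "n \<in> X" and Y: "Y \<in> B" "n \<in> Y \<or> Y = ?A" for X Y
    using Y(2)
  proof
    assume "n \<in> Y"
    then have "X \<inter> Y \<noteq> {}"
      using X(2) by blast
    with X(1) Y(1) B show ?thesis
      by (simp add: building_set_def)
  next
    assume "Y = ?A"
    moreover have "X \<union> ?A = {0..n}"
    proof
      have "x \<in> X \<union> ?A" if "x \<le> n" for x
        using that X(2) by (cases "x = n") auto
      then show "{0..n} \<subseteq> X \<union> ?A" by (meson atLeastAtMost_iff subsetI)
    qed (use BX(2)[OF X(1)] in auto)
    ultimately show ?thesis
      using top by simp
  qed
  have "building_colouring n B (m + n) c'"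
    unfolding building_colouring_def
  proof (intro conjI ballI impI image_subsetI)
    fix X assume X: "X \<in> B - {{0..n}}"
    show "c' X \<in> {1..m + n}"
      using low[of X] high[OF X] by (cases "X \<in> B' - {?A}") auto
  next
    fix X Y assume XY: "X \<in> B - {{0..n}}" "Y \<in> B - {{0..n}}" "X \<noteq> Y \<and> c' X = c' Y"
    have "\<not> X \<subseteq> Y \<and> X \<union> Y \<in> B"
    proof (cases "X \<in> B' - {?A}")
      case True
      then have Y: "Y \<in> B' - {?A}"
        using low[OF True] high[OF XY(2)] XY(3) by force
      have "c X = c Y"
        using XY(3) True Y unfolding c'_def by simp
      then have "\<not> X \<subseteq> Y \<and> X \<union> Y \<in> B'"
        using building_colouring_eqD[OF assms True Y] XY(3) by simp
      then show ?thesis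
        by (simp add: B')
    next
      case False
      then have Y: "Y \<notin> B' - {?A}"
        using low[of Y] high[OF XY(1)] XY(3) by force
      have "card X = card Y"
        using high(1)[OF XY(1) False] high(1)[OF XY(2) Y] XY(3) by simp
      then have "\<not> X \<subseteq> Y"
        using XY BX(3)[of Y] card_subset_eq[of Y X] by auto
      moreover have "X \<union> Y \<in> B"
        using join[of X Y] join[of Y X] outside[of X] outside[of Y] False Y XY
        by (auto simp: Un_commute)
      ultimately show ?thesis ..
    qed
    then show "\<not> X \<subseteq> Y" "X \<union> Y \<in> B" by auto
  qed
  then show thesis
    using that by blast
qed

end

section \<open>The cyclohedron and the associahedron\<close>

text \<open>Without the vertex \<open>n\<close>, the edge that closes the cycle is absent.\<close>

lemma path_building_set_eq_restricted_cycle: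
  assumes "n \<ge> 1"
  shows "graphical_building_set (n - 1) (path_edges (n - 1)) =
    {S \<in> graphical_building_set n (cycle_edges n). S \<subseteq> {0..n - 1}}"
proof -
  have "cycle_edges n \<inter> S \<times> S = path_edges (n - 1) \<inter> S \<times> S" if "S \<subseteq> {0..n - 1}" for S
    using that assms by (fastforce simp: cycle_edges_def path_edges_def)
  then show ?thesis
    using assms by (fastforce simp: graphical_building_set_def induces_connected_def)
qed

theorem proposition5p2:
  fixes n :: nat
    and C :: "'a::euclidean_space set"
    and K :: "'b::euclidean_space set"
  assumes "n \<ge> 2"
    and "is_cyclohedron n C"
    and "is_associahedron (n - 1) K"
  shows "chromatic_number K + 1 \<le> chromatic_number C \<and>
         chromatic_number C \<le> chromatic_number K + n"
proof -
  let ?B = "graphical_building_set n (cycle_edges n)"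
  let ?B' = "graphical_building_set (n - 1) (path_edges (n - 1))"
  have n: "n \<ge> 1"
    using assms(1) by simp
  note B' = path_building_set_eq_restricted_cycle[OF n]
  have top': "{0..n - 1} \<in> ?B"
    using graphical_building_sets_path_cycle(2)[of "n - 1"] B' by blast
  note B = graphical_building_sets_path_cycle(3)[of n] n
    graphical_building_sets_path_cycle(4)[of n] top' B'
  have C: "is_nestohedron n ?B C" and K: "is_nestohedron (n - 1) ?B' K"
    using assms by (auto simp: is_cyclohedron_def is_associahedron_def)
  obtain c where "building_colouring n ?B (chromatic_number C) c"
    using chromatic_number_attained[OF C] by blast
  then obtain c' where "chromatic_number C \<ge> 1"
    "building_colouring (n - 1) ?B' (chromatic_number C - 1) c'"
    using building_colouring_restrict[OF B] by blast
  then have "chromatic_number K + 1 \<le> chromatic_number C"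
    using chromatic_number_le[OF K] by fastforce
  moreover obtain d where "building_colouring (n - 1) ?B' (chromatic_number K) d"
    using chromatic_number_attained[OF K] by blast
  then obtain d' where "building_colouring n ?B (chromatic_number K + n) d'"
    using building_colouring_extend[OF B] by blast
  then have "chromatic_number C \<le> chromatic_number K + n"
    by (rule chromatic_number_le[OF C])
  ultimately show ?thesis ..
qed

end
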